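(* Let $M\subset\mathbb{R}^{2d}$ satisfy the standing assumptions below, let $T$ be its outer symplectic billiard map and let $F=\varphi_1$ be the time-one map of the flow $\varphi_t$ of the vector field $V$ defined below. Then there exist constants $\Delta>0$ and $K>0$, depending only on $M$, such that for all $x\in\mathbb{R}^{2d}$ with $|x|\ge \frac1\Delta$ one has $$|T^2(x)-F(x)|\le \frac{K}{|x|}.$$
   Context: Equip $\mathbb{R}^{2d}$ with the standard inner product $\langle\cdot,\cdot\rangle$, Euclidean norm $|\cdot|$, the standard complex structure $J$ (orthogonal, $J^2=-I$) and the symplectic form $\omega(u,v)=\langle Ju,v\rangle$. The Hamiltonian vector field $X_f$ of a function $f$ is defined by $\omega(\cdot,X_f)=df$, i.e. $X_f=J\nabla f$. Standing assumptions: $M\subset\mathbb{R}^{2d}$ is a smooth closed hypersurface bounding a strictly convex domain containing the origin in its interior, and $M$ is a level set of a smooth function with positive definite Hessian. For $q\in M$ the Reeb vector $R(q)$ is the unique vector with $\omega(v,R(q))=0$ for all $v\in T_qM$ and $\omega(q,R(q))=1$. Write $a\sim b$ if $a=\lambda b$ with $\lambda>0$. For $x$ in the exterior of $M$ there is a unique $m_-(x)\in M$ with $m_-(x)-x\sim R(m_-(x))$; the outer symplectic billiard map is $T(x)=2m_-(x)-x$. Let $G:M\to S^{2d-1}$ be the outward unit normal (Gauss) map, a diffeomorphism. For $x\neq 0$ put $n_+(x)=G^{-1}(-Jx/|x|)$, $n_-(x)=G^{-1}(Jx/|x|)$ (these are the points of $M$ with $R(n_+(x))\sim x$, $R(n_-(x))\sim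 -x$), and define the degree-zero homogeneous vector field $V(x)=2(n_+(x)-n_-(x))$ on $\mathbb{R}^{2d}\setminus\{0\}$; $\varphi_t$ denotes its flow. (Equivalently $V=-2X_H$ where $H$ is the positively $1$-homogeneous function whose unit level set is the symplectic polar $\{R'(q)\}$ of the symmetrization $M\oplus(-M)$, $R'$ being the Reeb vector of that symmetrization.) *)

theory Defs
  imports "HOL-Analysis.Analysis"
begin

text \<open>Phase space R^{2d} is modelled as (real^'d) \<times> (real^'d) (coordinates (q,p)),
  with the product Euclidean inner product and norm.\<close>

type_synonym 'd ps = "(real^'d) \<times> (real^'d)"

definition Jcx :: "'d::finite ps \<Rightarrow> 'd ps" where
  "Jcx x = (- snd x, fst x)"

definition omega :: "'d::finite ps \<Rightarrow> 'd ps \<Rightarrow> real" where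
  "omega u v = Jcx u \<bullet> v"

primrec Ck :: "nat \<Rightarrow> ('a::real_normed_vector \<Rightarrow> 'b::real_normed_vector) \<Rightarrow> bool" where
  "Ck 0 g = continuous_on UNIV g"
| "Ck (Suc k) g = ((\<forall>x. g differentiable (at x)) \<and> continuous_on UNIV g \<and>
                    (\<forall>v. Ck k (\<lambda>x. frechet_derivative g (at x) v)))"

definition smooth :: "('a::real_normed_vector \<Rightarrow> 'b::real_normed_vector) \<Rightarrow> bool" where
  "smooth g \<longleftrightarrow> (\<forall>k. Ck k g)"

definition hess_form :: "('a::real_normed_vector \<Rightarrow> real) \<Rightarrow> 'a \<Rightarrow> 'a \<Rightarrow> real" where
  "hess_form f x h = frechet_derivative (\<lambda>y. frechet_derivative f (at y) h) (at x) h"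

definition gradf :: "('a::real_inner \<Rightarrow> real) \<Rightarrow> 'a \<Rightarrow> 'a" where
  "gradf f x = (THE D. GDERIV f x :> D)"

text \<open>The hypersurface M = f^{-1}(c) and its tangent space at q (orthogonal complement
  of the gradient, M being a regular level set).\<close>
definition Mset :: "('a \<Rightarrow> real) \<Rightarrow> real \<Rightarrow> 'a set" where
  "Mset f c = {x. f x = c}"

definition tspace :: "('a::real_inner \<Rightarrow> real) \<Rightarrow> 'a \<Rightarrow> 'a set" where
  "tspace f q = {v. v \<bullet> gradf f q = 0}"

definition reeb :: "('d::finite ps \<Rightarrow> real) \<Rightarrow> 'd ps \<Rightarrow> 'd ps" where
  "reeb f q = (THE R. (\<forall>v\<in>tspace f q. omega v R = 0) \<and> omega q R = 1)"

definition posprop :: "'a::real_vector \<Rightarrow> 'a \<Rightarrow> bool" where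
  "posprop a b \<longleftrightarrow> (\<exists>l>0. a = l *\<^sub>R b)"

definition m_minus :: "('d::finite ps \<Rightarrow> real) \<Rightarrow> real \<Rightarrow> 'd ps \<Rightarrow> 'd ps" where
  "m_minus f c x = (THE m. m \<in> Mset f c \<and> posprop (m - x) (reeb f m))"

definition osb :: "('d::finite ps \<Rightarrow> real) \<Rightarrow> real \<Rightarrow> 'd ps \<Rightarrow> 'd ps" where
  "osb f c x = 2 *\<^sub>R m_minus f c x - x"

text \<open>Outward unit normal (Gauss map); the domain is {f < c}.\<close>
definition gauss :: "('a::real_inner \<Rightarrow> real) \<Rightarrow> 'a \<Rightarrow> 'a" where
  "gauss f q = (1 / norm (gradf f q)) *\<^sub>R gradf f q"

definition n_plus :: "('d::finite ps \<Rightarrow> real) \<Rightarrow> real \<Rightarrow> 'd ps \<Rightarrow> 'd ps" where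
  "n_plus f c x = inv_into (Mset f c) (gauss f) (- ((1 / norm x) *\<^sub>R Jcx x))"

definition n_minus :: "('d::finite ps \<Rightarrow> real) \<Rightarrow> real \<Rightarrow> 'd ps \<Rightarrow> 'd ps" where
  "n_minus f c x = inv_into (Mset f c) (gauss f) ((1 / norm x) *\<^sub>R Jcx x)"

definition Vfield :: "('d::finite ps \<Rightarrow> real) \<Rightarrow> real \<Rightarrow> 'd ps \<Rightarrow> 'd ps" where
  "Vfield f c x = 2 *\<^sub>R (n_plus f c x - n_minus f c x)"

definition time_one :: "('d::finite ps \<Rightarrow> real) \<Rightarrow> real \<Rightarrow> 'd ps \<Rightarrow> 'd ps" where
  "time_one f c x = (THE y. \<exists>\<gamma>. \<gamma> 0 = x \<and> \<gamma> 1 = y \<and>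
      (\<forall>t\<in>{0..1}. \<gamma> t \<noteq> 0 \<and>
         (\<gamma> has_vector_derivative Vfield f c (\<gamma> t)) (at t within {0..1})))"

end

theory Submission
  imports Defs
begin

text \<open>
  Strong convexity makes the inverse of the Gauss map Lipschitz, so \<open>P = n_minus\<close>, being homogeneous
  of degree zero, satisfies \<open>|P x - P y| \<le> A |x - y| / |x|\<close>. The tangency point \<open>m = m_minus x\<close> is
  the fixed point \<open>m = P (x - m)\<close>, hence \<open>m = P x + O(1/|x|)\<close>. Since \<open>T x = 2 m - x\<close> stays within
  bounded distance of \<open>- x\<close> and \<open>n_plus x = P (- x)\<close>, it follows that
  \<open>T (T x) = x + 2 (P (- x) - P x) + O(1/|x|)\<close>. The field \<open>V\<close> is bounded and varies by \<open>O(1/|x|)\<close>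
  over bounded distances, so its time-one map is \<open>x + V x + O(1/|x|)\<close> as well.
\<close>

section \<open>Gradient and Hessian of a smooth function\<close>

lemma smooth_differentiable: "smooth f \<Longrightarrow> f differentiable (at x)"
  by (auto simp: smooth_def dest!: spec[of _ "Suc 0"])

lemma smooth_frechet_derivative: "smooth f \<Longrightarrow> smooth (\<lambda>x. frechet_derivative f (at x) v)"
  unfolding smooth_def by (metis Ck.simps(2))

lemma smooth_continuous_on: "smooth f \<Longrightarrow> continuous_on S f"
  unfolding smooth_def by (metis Ck.simps(1) continuous_on_subset subset_UNIV)

lemma linear_eq_sum_Basis:
  fixes g :: "'a::euclidean_space \<Rightarrow> 'b::real_vector"
  assumes "linear g"
  shows "g h = (\<Sum>b\<in>Basis. (h \<bullet> b) *\<^sub>R g b)"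
proof -
  have "g h = g (\<Sum>b\<in>Basis. (h \<bullet> b) *\<^sub>R b)"
    by (simp add: euclidean_representation)
  also have "\<dots> = (\<Sum>b\<in>Basis. (h \<bullet> b) *\<^sub>R g b)"
    by (simp add: linear_sum[OF assms] linear_scale[OF assms])
  finally show ?thesis .
qed

text \<open>\<open>gradf\<close> is a definite description, so it must be shown to denote something:
  the vector whose coordinates are the derivative's values on the basis represents the derivative,
  and a linear functional determines its representing vector.\<close>

lemma gderiv_gradf:
  fixes f :: "'a::euclidean_space \<Rightarrow> real"
  assumes "f differentiable (at x)"
  shows "GDERIV f x :> gradf f x"
proof -
  let ?D = "frechet_derivative f (at x)"
  let ?g = "\<Sum>b\<in>Basis. ?D b *\<^sub>R b"
  have D: "(f has_derivative ?D) (at x)"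
    using assms frechet_derivative_works by blast
  then have lin: "linear ?D"
    using has_derivative_linear by blast
  have "?D h = h \<bullet> ?g" for h
    by (subst linear_eq_sum_Basis[OF lin]) (simp add: inner_sum_right mult.commute)
  then have "?D = (\<lambda>h. h \<bullet> ?g)" by blast
  with D have g: "GDERIV f x :> ?g"
    by (simp add: gderiv_def)
  moreover have "E = ?g" if "GDERIV f x :> E" for E
  proof -
    have "(\<lambda>h. h \<bullet> E) = (\<lambda>h. h \<bullet> ?g)"
      using g that has_derivative_unique unfolding gderiv_def by blast
    then show ?thesis
      by (metis vector_eq_ldot)
  qed
  ultimately show ?thesis
    unfolding gradf_def by (rule theI)
qed

lemma frechet_derivative_eq_gradf:
  fixes f :: "'a::euclidean_space \<Rightarrow> real"
  assumes "f differentiable (at x)"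
  shows "frechet_derivative f (at x) h = h \<bullet> gradf f x"
  using frechet_derivative_at[OF gderiv_gradf[OF assms, unfolded gderiv_def]] by metis

lemma continuous_on_gradf:
  fixes f :: "'a::euclidean_space \<Rightarrow> real"
  assumes "smooth f"
  shows "continuous_on S (gradf f)"
proof -
  have "gradf f = (\<lambda>x. \<Sum>b\<in>Basis. frechet_derivative f (at x) b *\<^sub>R b)"
    using assms
    by (simp add: frechet_derivative_eq_gradf smooth_differentiable inner_commute[of _ "gradf f _"]
        euclidean_representation)
  then show ?thesis
    using smooth_continuous_on[OF smooth_frechet_derivative[OF assms]]
    by (auto intro!: continuous_intros)
qed

text \<open>In \<open>hess_form\<close> the direction \<open>h\<close> occurs both inside and
  outside the outer derivative. Expanding both occurrences in the basis exhibits a quadratic form in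
  \<open>h\<close> with coefficients continuous in \<open>x\<close>, hence joint continuity.\<close>

lemma hess_form_eq_sum:
  fixes f :: "'a::euclidean_space \<Rightarrow> real"
  assumes "smooth f"
  shows "hess_form f x h = (\<Sum>a\<in>Basis. \<Sum>b\<in>Basis. (h \<bullet> a) * (h \<bullet> b) *
    frechet_derivative (\<lambda>y. frechet_derivative f (at y) a) (at x) b)"
proof -
  let ?D = "\<lambda>a. frechet_derivative (\<lambda>y. frechet_derivative f (at y) a) (at x)"
  have D: "((\<lambda>y. frechet_derivative f (at y) a) has_derivative ?D a) (at x)" for a
    using assms frechet_derivative_works smooth_differentiable smooth_frechet_derivative by blast
  have lin: "linear (?D a)" for a
    using D has_derivative_linear by blast
  have "(\<lambda>y. frechet_derivative f (at y) h) = (\<lambda>y. \<Sum>a\<in>Basis. (h \<bullet> a) * frechet_derivative f (at y) a)"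
    unfolding frechet_derivative_eq_gradf[OF smooth_differentiable[OF assms]]
    by (subst euclidean_inner) (simp add: inner_commute)
  moreover have "((\<lambda>y. \<Sum>a\<in>Basis. (h \<bullet> a) * frechet_derivative f (at y) a) has_derivative
      (\<lambda>v. \<Sum>a\<in>Basis. (h \<bullet> a) * ?D a v)) (at x)"
    by (intro has_derivative_sum has_derivative_mult_right D)
  ultimately have "((\<lambda>y. frechet_derivative f (at y) h) has_derivative
      (\<lambda>v. \<Sum>a\<in>Basis. (h \<bullet> a) * ?D a v)) (at x)"
    by simp
  from fun_cong[OF frechet_derivative_at[OF this], of h]
  have "hess_form f x h = (\<Sum>a\<in>Basis. (h \<bullet> a) * ?D a h)"
    unfolding hess_form_def by (rule sym)
  also have "\<dots> = (\<Sum>a\<in>Basis. (h \<bullet> a) * (\<Sum>b\<in>Basis. (h \<bullet> b) * ?D a b))"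
    by (simp add: linear_eq_sum_Basis[OF lin, where h = h])
  finally show ?thesis
    by (simp add: sum_distrib_left mult.assoc)
qed

lemma hess_form_scaleR:
  fixes f :: "'a::euclidean_space \<Rightarrow> real"
  assumes "smooth f"
  shows "hess_form f x (r *\<^sub>R h) = r\<^sup>2 * hess_form f x h"
  by (simp add: hess_form_eq_sum[OF assms] sum_distrib_left power2_eq_square mult_ac)

text \<open>The Hessian form attains a positive minimum on the compact product of \<open>S\<close>
  with the unit sphere; homogeneity of degree two carries the bound to all \<open>h\<close>.\<close>

lemma hess_form_lower_bound:
  fixes f :: "'a::euclidean_space \<Rightarrow> real"
  assumes "smooth f" and pos: "\<And>x h. h \<noteq> 0 \<Longrightarrow> hess_form f x h > 0" and "compact S"
  obtains \<mu> where "\<mu> > 0" "\<And>x h. x \<in> S \<Longrightarrow> hess_form f x h \<ge> \<mu> * (norm h)\<^sup>2"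
proof (cases "S = {}")
  case True
  then show ?thesis using that[of 1] by simp
next
  case False
  let ?C = "S \<times> sphere (0::'a) 1"
  have "compact ?C" "?C \<noteq> {}"
    using False assms(3) by (auto simp: compact_Times)
  moreover have "continuous_on ?C (\<lambda>(x, h). hess_form f x h)"
    unfolding hess_form_eq_sum[OF assms(1)] case_prod_beta
    by (intro continuous_intros continuous_on_compose2[of UNIV _ _ fst] smooth_continuous_on
        smooth_frechet_derivative assms(1)) auto
  ultimately obtain p where p: "p \<in> ?C"
    "\<And>z. z \<in> ?C \<Longrightarrow> (\<lambda>(x, h). hess_form f x h) p \<le> (\<lambda>(x, h). hess_form f x h) z"
    using continuous_attains_inf[of ?C] by metis
  define \<mu> where "\<mu> = (\<lambda>(x, h). hess_form f x h) p"
  have "snd p \<noteq> 0" using p(1) by auto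
  then have "\<mu> > 0"
    unfolding \<mu>_def case_prod_beta by (rule pos)
  moreover have "hess_form f x h \<ge> \<mu> * (norm h)\<^sup>2" if "x \<in> S" for x h
  proof (cases "h = 0")
    case True
    then show ?thesis using hess_form_scaleR[OF assms(1), of x 0 0] by simp
  next
    case False
    have "\<mu> \<le> hess_form f x (h /\<^sub>R norm h)"
      using p(2)[of "(x, h /\<^sub>R norm h)"] that False by (simp add: \<mu>_def)
    then have "\<mu> * (norm h)\<^sup>2 \<le> hess_form f x (h /\<^sub>R norm h) * (norm h)\<^sup>2"
      by (simp add: mult_right_mono)
    also have "\<dots> = hess_form f x h"
      using False by (simp add: hess_form_scaleR[OF assms(1)] field_simps)
    finally show ?thesis .
  qed
  ultimately show ?thesis using that by blast
qed

section \<open>Convexity estimates along segments\<close>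

lemma has_real_derivative_along_line:
  fixes g :: "'a::euclidean_space \<Rightarrow> real"
  assumes "g differentiable (at (p + t *\<^sub>R h))"
  shows "((\<lambda>t. g (p + t *\<^sub>R h)) has_real_derivative h \<bullet> gradf g (p + t *\<^sub>R h)) (at t)"
proof -
  let ?l = "\<lambda>t. p + t *\<^sub>R h"
  have "(?l has_derivative (\<lambda>s. s *\<^sub>R h)) (at t)"
    by (auto intro!: derivative_eq_intros)
  from has_derivative_compose[OF this gderiv_gradf[OF assms, unfolded gderiv_def]]
  show ?thesis
    by (simp add: has_field_derivative_def mult_commute_abs)
qed

text \<open>Second-order Taylor expansion along the segment from \<open>p\<close> to
  \<open>q\<close>: the Lagrange remainder is half the Hessian form at a point of the segment, which
  lies in the convex set \<open>S\<close>.\<close>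

lemma strong_convexity:
  fixes f :: "'a::euclidean_space \<Rightarrow> real"
  assumes "smooth f" and "convex S" and p: "p \<in> S" and q: "q \<in> S"
    and lower: "\<And>x h. x \<in> S \<Longrightarrow> hess_form f x h \<ge> \<mu> * (norm h)\<^sup>2"
  shows "f q \<ge> f p + (q - p) \<bullet> gradf f p + \<mu> / 2 * (norm (q - p))\<^sup>2"
proof -
  define h where "h = q - p"
  let ?l = "\<lambda>t. p + t *\<^sub>R h"
  let ?diff = "\<lambda>m::nat. if m = 0 then (\<lambda>t. f (?l t))
    else if m = 1 then (\<lambda>t. frechet_derivative f (at (?l t)) h) else (\<lambda>t. hess_form f (?l t) h)"
  have D: "((\<lambda>t. g (?l t)) has_real_derivative frechet_derivative g (at (?l t)) h) (at t)"
    if "smooth g" for g :: "'a \<Rightarrow> real" and t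
    using has_real_derivative_along_line frechet_derivative_eq_gradf smooth_differentiable[OF that]
    by metis
  have "\<exists>t>0. t < 1 \<and> f (?l 1) = (\<Sum>m<2. ?diff m 0 / fact m * 1 ^ m) + ?diff 2 t / fact 2 * 1 ^ 2"
  proof (rule Maclaurin)
    show "\<forall>m t. m < 2 \<and> 0 \<le> t \<and> t \<le> 1 \<longrightarrow> (?diff m has_real_derivative ?diff (Suc m) t) (at t)"
      using D[OF assms(1)] D[OF smooth_frechet_derivative[OF assms(1)], of h]
      by (auto simp: less_2_cases_iff hess_form_def)
  qed auto
  then obtain t where t: "0 < t" "t < 1"
    and eq: "f q = f p + h \<bullet> gradf f p + hess_form f (?l t) h / 2"
    by (auto simp: h_def numeral_2_eq_2 frechet_derivative_eq_gradf smooth_differentiable assms(1))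
  have "?l t = (1 - t) *\<^sub>R p + t *\<^sub>R q"
    by (simp add: h_def algebra_simps)
  then have "?l t \<in> S"
    using convexD[OF assms(2) p q, of "1 - t" t] t by simp
  from lower[OF this, of h] have "\<mu> / 2 * (norm h)\<^sup>2 \<le> hess_form f (?l t) h / 2"
    by simp
  with eq show ?thesis
    unfolding h_def by linarith
qed


text \<open>Convexity, compared at \<open>p\<close> and the origin, gives
  \<open>f 0 \<ge> f p - p \<bullet> gradf f p\<close>. On the level set this makes the gradient
  nonzero and the normalisation of the Reeb vector possible.\<close>

lemma inner_gradf_pos:
  fixes f :: "'a::euclidean_space \<Rightarrow> real"
  assumes "smooth f" and pos: "\<And>x h. h \<noteq> 0 \<Longrightarrow> hess_form f x h > 0"
    and "f 0 < f p"
  shows "p \<bullet> gradf f p > 0"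
proof -
  have "hess_form f x h \<ge> 0 * (norm h)\<^sup>2" for x h
    using pos[of h x] hess_form_scaleR[OF assms(1), of x 0 h] by (cases "h = 0") auto
  then show ?thesis
    using strong_convexity[OF assms(1), of UNIV p 0 0] assms(3) by simp
qed

section \<open>The Gauss map: surjectivity and Lipschitz inverse\<close>

text \<open>A point of the sublevel set maximising \<open>u \<bullet> x\<close> has normal
  \<open>u\<close>. It cannot be interior, and if its normal \<open>w\<close> differed from
  \<open>u\<close>, a small step along \<open>u - w\<close> would increase
  \<open>u \<bullet> x\<close> while decreasing \<open>f\<close>.\<close>

lemma gauss_surj:
  fixes f :: "'a::euclidean_space \<Rightarrow> real"
  assumes "smooth f" and grad: "\<And>p. f p = c \<Longrightarrow> gradf f p \<noteq> 0"
    and "f 0 < c" and bdd: "bounded {x. f x \<le> c}" and u: "norm u = 1"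
  shows "\<exists>p \<in> Mset f c. gauss f p = u"
proof -
  let ?K = "{x. f x \<le> c}"
  have cont: "continuous_on UNIV f"
    using smooth_continuous_on[OF assms(1)] .
  have "closed ?K"
    using cont by (intro closed_Collect_le continuous_intros)
  with bdd have "compact ?K"
    by (simp add: compact_eq_bounded_closed)
  moreover have "?K \<noteq> {}"
    using assms(3) by (auto intro: exI[of _ 0])
  moreover have "continuous_on ?K (\<lambda>x. u \<bullet> x)"
    by (intro continuous_intros)
  ultimately obtain p where p: "f p \<le> c" "\<And>x. f x \<le> c \<Longrightarrow> u \<bullet> x \<le> u \<bullet> p"
    using continuous_attains_sup[of ?K "\<lambda>x. u \<bullet> x"] by auto
  have "\<not> f p < c"
  proof
    assume "f p < c"
    have "open {x. f x < c}"
      using cont by (intro open_Collect_less continuous_intros)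
    then obtain e where e: "e > 0" "ball p e \<subseteq> {x. f x < c}"
      using \<open>f p < c\<close> by (auto simp: open_contains_ball)
    have "p + (e / 2) *\<^sub>R u \<in> ball p e"
      using e u by (simp add: dist_norm)
    with e p(2)[of "p + (e / 2) *\<^sub>R u"] have "u \<bullet> (p + (e / 2) *\<^sub>R u) \<le> u \<bullet> p"
      by (auto intro: less_imp_le)
    with e u show False
      by (simp add: inner_add_right norm_eq_1)
  qed
  with p(1) have fp: "f p = c" by simp
  let ?w = "gauss f p"
  have w: "norm ?w = 1" and gw: "gradf f p = norm (gradf f p) *\<^sub>R ?w"
    using grad[OF fp] by (auto simp: gauss_def)
  have "?w = u"
  proof (rule ccontr)
    assume ne: "?w \<noteq> u"
    have "(norm (u - ?w))\<^sup>2 = 2 - 2 * (u \<bullet> ?w)"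
      using u w by (simp add: power2_norm_eq_inner inner_diff inner_commute norm_eq_1)
    moreover have "(norm (u - ?w))\<^sup>2 > 0"
      using ne by simp
    ultimately have less: "u \<bullet> ?w < 1" by simp
    have "(u - ?w) \<bullet> gradf f p = norm (gradf f p) * (u \<bullet> ?w - 1)"
      by (subst gw) (use w in \<open>simp add: inner_diff norm_eq_1 right_diff_distrib\<close>)
    also have "\<dots> < 0"
      using grad[OF fp] less by (simp add: mult_pos_neg)
    finally have "(u - ?w) \<bullet> gradf f (p + 0 *\<^sub>R (u - ?w)) < 0" by simp
    from DERIV_neg_dec_right[OF has_real_derivative_along_line this]
    obtain d where d: "d > 0" "\<And>h. \<lbrakk>0 < h; h < d\<rbrakk> \<Longrightarrow> f (p + h *\<^sub>R (u - ?w)) < c"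
      using smooth_differentiable[OF assms(1)] fp by auto
    have "u \<bullet> (p + (d / 2) *\<^sub>R (u - ?w)) \<le> u \<bullet> p"
      using d(1) by (intro p(2) less_imp_le d(2)) auto
    then have "d * (1 - u \<bullet> ?w) \<le> 0"
      using u by (simp add: inner_add_right inner_diff_right norm_eq_1)
    with d(1) less show False
      by (simp add: mult_le_0_iff)
  qed
  with fp show ?thesis by (auto simp: Mset_def)
qed

text \<open>Strong convexity gives \<open>G p \<bullet> (p - q) \<ge> \<kappa> |p - q|\<^sup>2\<close> for two points of the same level set;
  adding the inequality with \<open>p\<close> and \<open>q\<close> exchanged bounds \<open>|p - q|\<close> by \<open>|G p - G q|\<close>.\<close>

lemma gauss_expanding:
  fixes f :: "'a::euclidean_space \<Rightarrow> real"
  assumes "smooth f" and pos: "\<And>x h. h \<noteq> 0 \<Longrightarrow> hess_form f x h > 0"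
    and grad: "\<And>p. f p = c \<Longrightarrow> gradf f p \<noteq> 0" and bdd: "bounded {x. f x \<le> c}"
  obtains L where "L > 0"
    "\<And>p q. \<lbrakk>p \<in> Mset f c; q \<in> Mset f c\<rbrakk> \<Longrightarrow> norm (p - q) \<le> L * norm (gauss f p - gauss f q)"
proof -
  obtain D where D: "\<And>x. f x \<le> c \<Longrightarrow> norm x \<le> D"
    using bdd by (auto simp: bounded_iff)
  \<comment> \<open>The ball replaces the sublevel set because it is evidently convex and compact,
    as the Taylor estimate and the uniform bounds require.\<close>
  obtain \<mu> where \<mu>: "\<mu> > 0" "\<And>x h. x \<in> cball 0 D \<Longrightarrow> hess_form f x h \<ge> \<mu> * (norm h)\<^sup>2"
    using hess_form_lower_bound[OF assms(1) pos compact_cball] by metis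
  have "bounded (gradf f ` cball 0 D)"
    using compact_continuous_image[OF continuous_on_gradf[OF assms(1)] compact_cball]
    by (rule compact_imp_bounded)
  then obtain B where B: "B > 0" "\<And>x. norm x \<le> D \<Longrightarrow> norm (gradf f x) \<le> B"
    unfolding bounded_pos by auto
  define \<kappa> where "\<kappa> = \<mu> / (2 * B)"
  have "\<kappa> > 0" using \<mu> B by (simp add: \<kappa>_def)
  have half: "gauss f p \<bullet> (p - q) \<ge> \<kappa> * (norm (p - q))\<^sup>2" if "f p = c" "f q = c" for p q
  proof -
    let ?g = "gradf f p"
    have "\<mu> / 2 * (norm (p - q))\<^sup>2 \<le> (p - q) \<bullet> ?g"
      using strong_convexity[OF assms(1) convex_cball[of 0 D] _ _ \<mu>(2), of p q] D[of p] D[of q] that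
      by (simp add: norm_minus_commute inner_diff_left)
    also have "\<dots> = norm ?g * (gauss f p \<bullet> (p - q))"
      using grad[OF that(1)] by (simp add: gauss_def inner_commute)
    finally have *: "\<mu> / 2 * (norm (p - q))\<^sup>2 \<le> norm ?g * (gauss f p \<bullet> (p - q))" .
    \<comment> \<open>The sign of the inner product has to be settled before the gradient norm can
      be replaced by its upper bound \<open>B\<close>.\<close>
    moreover have "0 \<le> \<mu> / 2 * (norm (p - q))\<^sup>2" using \<mu>(1) by simp
    ultimately have "0 \<le> gauss f p \<bullet> (p - q)"
      using grad[OF that(1)] by (smt (verit) mult_pos_neg zero_less_norm_iff)
    then have "norm ?g * (gauss f p \<bullet> (p - q)) \<le> B * (gauss f p \<bullet> (p - q))"
      using B(2)[of p] D[of p] that by (intro mult_right_mono) auto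
    with * have "\<mu> / 2 * (norm (p - q))\<^sup>2 \<le> B * (gauss f p \<bullet> (p - q))" by linarith
    then show ?thesis
      using B(1) by (simp add: \<kappa>_def field_simps)
  qed
  have "norm (p - q) \<le> 1 / (2 * \<kappa>) * norm (gauss f p - gauss f q)" if "f p = c" "f q = c" for p q
  proof (cases "p = q")
    case False
    have "2 * \<kappa> * (norm (p - q))\<^sup>2 \<le> (gauss f p - gauss f q) \<bullet> (p - q)"
      using half[OF that] half[OF that(2) that(1)]
      by (simp add: inner_diff norm_minus_commute)
    also have "\<dots> \<le> norm (gauss f p - gauss f q) * norm (p - q)"
      by (rule norm_cauchy_schwarz)
    finally have "2 * \<kappa> * norm (p - q) \<le> norm (gauss f p - gauss f q)"
      using False by (simp add: power2_eq_square flip: mult.assoc)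
    then show ?thesis
      using \<open>\<kappa> > 0\<close> by (simp add: field_simps)
  qed simp
  with \<open>\<kappa> > 0\<close> show ?thesis
    by (intro that[of "1 / (2 * \<kappa>)"]) (auto simp: Mset_def)
qed


section \<open>Differential equations over unit time\<close>

text \<open>Mean value inequality on an interval of length one. It serves to confine trajectories,
  to contract the Picard operator, to prove uniqueness and to compare with straight motion.\<close>

lemma norm_bound_unit_interval:
  fixes \<gamma> :: "real \<Rightarrow> 'a::real_normed_vector"
  assumes "\<And>t. t \<in> {0..1} \<Longrightarrow> (\<gamma> has_vector_derivative \<gamma>' t) (at t within {0..1})"
    and "\<And>t. t \<in> {0..1} \<Longrightarrow> norm (\<gamma>' t) \<le> B" and t: "t \<in> {0..1}"
  shows "norm (\<gamma> t - \<gamma> 0) \<le> B"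
proof -
  have "B \<ge> 0"
    using assms(2)[of 0] by (auto intro: order_trans[OF norm_ge_zero])
  have "norm (\<gamma> t - \<gamma> 0) \<le> B * norm (t - 0)"
  proof (rule differentiable_bound)
    show "(\<gamma> has_derivative (\<lambda>s. s *\<^sub>R \<gamma>' u)) (at u within {0..1})" if "u \<in> {0..1}" for u
      using assms(1)[OF that] by (simp add: has_vector_derivative_def)
    show "onorm (\<lambda>s. s *\<^sub>R \<gamma>' u) \<le> B" if "u \<in> {0..1}" for u
    proof (rule onorm_bound[OF \<open>B \<ge> 0\<close>])
      show "norm (s *\<^sub>R \<gamma>' u) \<le> B * norm s" for s
        using mult_right_mono[OF assms(2)[OF that], of "\<bar>s\<bar>"] by (simp add: mult.commute)
    qed
  qed (use t in auto)
  also have "\<dots> \<le> B * 1"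
    using t \<open>B \<ge> 0\<close> by (intro mult_left_mono) auto
  finally show ?thesis by simp
qed

text \<open>Speed at most \<open>B\<close> keeps Picard iterates in the ball for the whole unit of
  time, and the Lipschitz constant 1/2 makes the Picard operator a contraction there, so one fixed
  point covers the entire interval.\<close>

lemma picard_unit_interval:
  fixes V :: "'a::banach \<Rightarrow> 'a"
  assumes bnd: "\<And>y. y \<in> cball x B \<Longrightarrow> norm (V y) \<le> B"
    and lip: "\<And>y z. \<lbrakk>y \<in> cball x B; z \<in> cball x B\<rbrakk> \<Longrightarrow> norm (V y - V z) \<le> 1/2 * norm (y - z)"
    and "B \<ge> 0"
  obtains \<gamma> where "\<gamma> 0 = x" "\<And>t. t \<in> {0..1} \<Longrightarrow> \<gamma> t \<in> cball x B"
    "\<And>t. t \<in> {0..1} \<Longrightarrow> (\<gamma> has_vector_derivative V (\<gamma> t)) (at t within {0..1})"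
proof -
  \<comment> \<open>Clamping to the unit interval: the complete function space consists of bounded
    continuous functions on the whole line, so iterates are extended by constants.\<close>
  define \<tau> where "\<tau> t = max 0 (min 1 t)" for t :: real
  have \<tau>: "\<tau> t \<in> {0..1}" and \<tau>_id: "t \<in> {0..1} \<Longrightarrow> \<tau> t = t" for t
    by (auto simp: \<tau>_def)
  have cont_\<tau>: "continuous_on UNIV \<tau>"
    unfolding \<tau>_def by (intro continuous_intros)
  have contV: "continuous_on (cball x B) V"
  proof (rule lipschitz_on_continuous_on)
    show "(1/2)-lipschitz_on (cball x B) V"
      using lip by (intro lipschitz_onI) (auto simp: dist_norm)
  qed
  define S :: "(real \<Rightarrow>\<^sub>C 'a) set" where "S = PiC UNIV (\<lambda>_. cball x B)"
  have S: "g \<in> S \<longleftrightarrow> (\<forall>t. apply_bcontfun g t \<in> cball x B)" for g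
    by (auto simp: S_def mem_PiC_iff)
  define I where "I g t = x + integral {0..t} (\<lambda>s. V (apply_bcontfun g s))" for g :: "real \<Rightarrow>\<^sub>C 'a" and t
  have contVg: "continuous_on {0..1} (\<lambda>s. V (apply_bcontfun g s))" if "g \<in> S" for g
    using that by (intro continuous_on_compose2[OF contV]) (auto simp: S)
  have I_deriv: "(I g has_vector_derivative V (apply_bcontfun g t)) (at t within {0..1})"
    if "g \<in> S" "t \<in> {0..1}" for g t
  proof -
    have "((\<lambda>u. integral {0..u} (\<lambda>s. V (apply_bcontfun g s))) has_vector_derivative
        V (apply_bcontfun g t)) (at t within {0..1})"
      using integral_has_vector_derivative[OF contVg[OF that(1)] that(2)] .
    from has_vector_derivative_add[OF has_vector_derivative_const[of x] this]
    show ?thesis unfolding I_def by simp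
  qed
  have I0: "I g 0 = x" for g by (simp add: I_def)
  have I_ball: "I g (\<tau> t) \<in> cball x B" if "g \<in> S" for g t
    using norm_bound_unit_interval[OF I_deriv[OF that] bnd \<tau>, of t] that
    by (auto simp: S I0 dist_norm norm_minus_commute)
  have "(\<lambda>t. I g (\<tau> t)) \<in> bcontfun" if "g \<in> S" for g
  proof -
    have "continuous_on {0..1} (I g)"
      by (rule continuous_on_vector_derivative) (rule I_deriv[OF that])
    then have "continuous_on UNIV (\<lambda>t. I g (\<tau> t))"
      by (rule continuous_on_compose2[OF _ cont_\<tau>]) (use \<tau> in blast)
    moreover have "bounded (range (\<lambda>t. I g (\<tau> t)))"
      using I_ball[OF that] by (intro bounded_subset[OF bounded_cball[of x B]]) blast
    ultimately show ?thesis by (simp add: bcontfun_def)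
  qed
  then have \<Phi>: "apply_bcontfun (Bcontfun (\<lambda>t. I g (\<tau> t))) t = I g (\<tau> t)" if "g \<in> S" for g t
    using that by (simp add: Bcontfun_inverse)
  have "\<exists>!g\<in>S. Bcontfun (\<lambda>t. I g (\<tau> t)) = g"
  proof (rule Banach_fix[where c = "1/2"])
    show "complete S"
      unfolding S_def complete_eq_closed by (intro closed_PiC) auto
    show "S \<noteq> {}"
    proof -
      have "const_bcontfun x \<in> S"
        using \<open>B \<ge> 0\<close> by (simp add: S const_bcontfun.rep_eq)
      then show ?thesis by blast
    qed
    show "(\<lambda>g. Bcontfun (\<lambda>t. I g (\<tau> t))) ` S \<subseteq> S"
      using I_ball by (auto simp: S \<Phi>)
    fix g h assume gh: "g \<in> S" "h \<in> S"
    show "dist (Bcontfun (\<lambda>t. I g (\<tau> t))) (Bcontfun (\<lambda>t. I h (\<tau> t))) \<le> 1/2 * dist g h"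
    proof (rule dist_bound)
      fix t
      \<comment> \<open>The two iterates start at the same point, so a bound on the derivative of
        their difference bounds the difference itself.\<close>
      have "norm ((\<lambda>t. I g t - I h t) (\<tau> t) - (\<lambda>t. I g t - I h t) 0) \<le> 1/2 * dist g h"
      proof (rule norm_bound_unit_interval[OF _ _ \<tau>])
        fix s :: real assume s: "s \<in> {0..1}"
        show "((\<lambda>t. I g t - I h t) has_vector_derivative
            V (apply_bcontfun g s) - V (apply_bcontfun h s)) (at s within {0..1})"
          using gh s by (intro has_vector_derivative_diff I_deriv)
        have "norm (V (apply_bcontfun g s) - V (apply_bcontfun h s)) \<le>
            1/2 * dist (apply_bcontfun g s) (apply_bcontfun h s)"
          using gh lip by (auto simp: S dist_norm)
        also have "\<dots> \<le> 1/2 * dist g h"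
          using dist_bounded[of g s h] by simp
        finally show "norm (V (apply_bcontfun g s) - V (apply_bcontfun h s)) \<le> 1/2 * dist g h" .
      qed
      then show "dist (apply_bcontfun (Bcontfun (\<lambda>t. I g (\<tau> t))) t)
          (apply_bcontfun (Bcontfun (\<lambda>t. I h (\<tau> t))) t) \<le> 1/2 * dist g h"
        using gh by (simp add: \<Phi> I0 dist_norm)
    qed
  qed auto
  then obtain g where g: "g \<in> S" "Bcontfun (\<lambda>t. I g (\<tau> t)) = g" by blast
  have g_eq: "apply_bcontfun g t = I g t" if "t \<in> {0..1}" for t
    using \<Phi>[OF g(1), of t] g(2) \<tau>_id[OF that] by simp
  show ?thesis
  proof (rule that[of "I g"])
    show "I g 0 = x" by (rule I0)
    show "I g t \<in> cball x B" if "t \<in> {0..1}" for t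
      using I_ball[OF g(1), of t] \<tau>_id[OF that] by simp
    show "(I g has_vector_derivative V (I g t)) (at t within {0..1})" if "t \<in> {0..1}" for t
      using I_deriv[OF g(1) that] g_eq[OF that] by simp
  qed
qed

section \<open>Estimates for an abstract map in the role of \<open>n_minus\<close>\<close>

text \<open>\<open>P\<close> abstracts \<open>n_minus\<close>: \<open>D\<close> bounds the size of
  the hypersurface, and the Lipschitz bound decaying like the inverse norm is what homogeneity of
  degree zero provides.\<close>

locale inverse_decay_lipschitz =
  fixes P :: "'a::banach \<Rightarrow> 'a" and A D :: real
  assumes A_nonneg: "A \<ge> 0" and D_nonneg: "D \<ge> 0"
    and bounded_P: "\<And>x. x \<noteq> 0 \<Longrightarrow> norm (P x) \<le> D"
    and lipschitz_P: "\<And>x y. \<lbrakk>x \<noteq> 0; y \<noteq> 0\<rbrakk> \<Longrightarrow> norm (P x - P y) \<le> A * norm (x - y) / norm x"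
begin

lemma lipschitz_P':
  assumes "0 < r" "r \<le> norm x" "y \<noteq> 0" "norm (x - y) \<le> e"
  shows "norm (P x - P y) \<le> A * e / r"
proof -
  have "e \<ge> 0"
    using assms(4) norm_ge_zero order_trans by blast
  have "norm (P x - P y) \<le> A * norm (x - y) / norm x"
    using assms by (intro lipschitz_P) auto
  also have "\<dots> \<le> A * e / r"
    using assms A_nonneg \<open>e \<ge> 0\<close> by (intro frac_le mult_left_mono) auto
  finally show ?thesis .
qed

text \<open>For \<open>m\<close> in the ball of radius \<open>D\<close>, the point
  \<open>x - m\<close> has norm at least \<open>2 * A + 1\<close>, so \<open>P (x - m)\<close>
  contracts in \<open>m\<close> with factor at most 1/2. Every solution lies in that ball, since
  \<open>m \<noteq> x\<close> lets the bound on \<open>P\<close> apply.\<close>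

lemma ex1_fixed_point:
  assumes x: "norm x \<ge> D + 2 * A + 1"
  shows "\<exists>!m. m \<noteq> x \<and> P (x - m) = m"
proof -
  have far: "norm (x - m) \<ge> 2 * A + 1" if "norm m \<le> D" for m
    using norm_triangle_ineq2[of x m] that x by linarith
  have "\<exists>!m. m \<in> cball 0 D \<and> P (x - m) = m"
  proof (rule Banach_fix[where c = "1/2"])
    show "(\<lambda>m. P (x - m)) ` cball 0 D \<subseteq> cball 0 D"
      using far A_nonneg by (force intro!: bounded_P)
    fix m m' :: 'a assume "m \<in> cball 0 D" "m' \<in> cball 0 D"
    then have m: "norm m \<le> D" "norm m' \<le> D" by auto
    then have "norm (P (x - m) - P (x - m')) \<le> A * norm (m - m') / (2 * A + 1)"
      using far[of m] far[of m'] A_nonneg by (intro lipschitz_P') (auto simp: norm_minus_commute)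
    also have "\<dots> = A / (2 * A + 1) * norm (m - m')" by simp
    also have "\<dots> \<le> 1/2 * norm (m - m')"
      using A_nonneg by (intro mult_right_mono) (auto simp: field_simps)
    finally show "dist (P (x - m)) (P (x - m')) \<le> 1/2 * dist m m'"
      by (simp add: dist_norm)
  qed (use D_nonneg in \<open>auto simp: complete_eq_closed\<close>)
  moreover have "m \<in> cball 0 D" if "m \<noteq> x" "P (x - m) = m" for m
    using bounded_P[of "x - m"] that by auto
  moreover have "m \<noteq> x" if "m \<in> cball 0 D" for m
    using far[of m] that A_nonneg by auto
  ultimately show ?thesis by metis
qed

text \<open>With \<open>y = T x\<close>, the second iterate is \<open>x + 2 (m y - m x)\<close>.
  Replacing \<open>m y\<close> by \<open>P y\<close>, \<open>P y\<close> by \<open>P (- x)\<close>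
  and \<open>m x\<close> by \<open>P x\<close> changes the argument of \<open>P\<close> by a bounded
  amount each time.\<close>

lemma second_reflection_estimate:
  assumes m: "\<And>x. norm x \<ge> D + 2 * A + 1 \<Longrightarrow> m x \<noteq> x \<and> P (x - m x) = m x"
    and T: "\<And>x. T x = 2 *\<^sub>R m x - x"
    and x: "norm x \<ge> 8 * D + 8 * A + 1"
  shows "norm (T (T x) - (x + 2 *\<^sub>R (P (- x) - P x))) \<le> 10 * A * D / norm x"
proof -
  note nn = A_nonneg D_nonneg
  have D: "norm (m y) \<le> D" if "norm y \<ge> D + 2 * A + 1" for y
    using m[OF that] bounded_P[of "y - m y"] by auto
  \<comment> \<open>Here \<open>m y = P (y - m y)\<close>, and its argument is within
    \<open>D\<close> of \<open>y\<close>.\<close>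
  have est: "norm (m y - P y) \<le> A * D / r" if "norm y \<ge> D + 2 * A + 1" "0 < r" "r \<le> norm y" for y r
    using lipschitz_P'[OF that(2,3), of "y - m y" D] m[OF that(1)] D[OF that(1)]
    by (auto simp: norm_minus_commute)
  define y where "y = T x"
  have x1: "norm x \<ge> D + 2 * A + 1" and xpos: "norm x > 0" using x nn by linarith+
  have yx: "norm (- x - y) \<le> 2 * D"
    using D[OF x1] by (simp add: y_def T)
  then have ny: "norm y \<ge> norm x - 2 * D"
    using norm_triangle_ineq2[of "- x" y] by simp
  \<comment> \<open>The threshold on \<open>x\<close> leaves room for the loss of
    \<open>2 * D\<close>: the fixed-point equation remains available at \<open>y\<close>.\<close>
  have y1: "norm y \<ge> D + 2 * A + 1" and y2: "norm y \<ge> norm x / 2"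
    using ny x nn by linarith+
  have "y \<noteq> 0" using y2 xpos by auto
  define q where "q = A * D / norm x"
  have e1: "norm (m x - P x) \<le> q"
    using est[OF x1 xpos] by (simp add: q_def)
  have e2: "norm (m y - P y) \<le> 2 * q"
    using est[OF y1 _ y2] xpos by (simp add: q_def mult_ac)
  have e3: "norm (P y - P (- x)) \<le> 2 * q"
    using lipschitz_P'[OF xpos, of "- x" y "2 * D"] yx \<open>y \<noteq> 0\<close>
    by (simp add: norm_minus_commute q_def mult_ac)
  have "T (T x) - (x + 2 *\<^sub>R (P (- x) - P x))
      = 2 *\<^sub>R ((m y - P y) + (P y - P (- x)) - (m x - P x))"
    unfolding T[of "T x"] y_def[symmetric] by (simp add: y_def T algebra_simps)
  also have "norm \<dots> \<le> 2 * (norm (m y - P y) + norm (P y - P (- x)) + norm (m x - P x))"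
    unfolding norm_scaleR
    by (intro mult_mono norm_triangle_le_diff add_mono norm_triangle_ineq order_refl) auto
  \<comment> \<open>The three errors are \<open>2 * q\<close>, \<open>2 * q\<close> and
    \<open>q\<close>. The first factor 2 comes from the halved norm of \<open>y\<close>, the second
    from the displacement \<open>2 * D\<close>.\<close>
  also have "\<dots> \<le> 10 * q"
    using add_mono[OF add_mono[OF e2 e3] e1] by simp
  finally show ?thesis by (simp add: q_def)
qed

text \<open>\<open>W\<close> has speed at most \<open>4 * D\<close>, so unit-time trajectories stay
  in a ball where \<open>W\<close> has Lipschitz constant 1/2; this gives existence and uniqueness.
  Along them \<open>W\<close> deviates from \<open>W x\<close> by at most
  \<open>16 * A * D / norm x\<close>.\<close>

lemma time_one_estimate:
  defines "W \<equiv> \<lambda>x. 2 *\<^sub>R (P (- x) - P x)"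
  assumes x: "norm x \<ge> 8 * D + 8 * A + 1"
  shows "norm ((THE y. \<exists>\<gamma>. \<gamma> 0 = x \<and> \<gamma> 1 = y \<and>
      (\<forall>t\<in>{0..1}. \<gamma> t \<noteq> 0 \<and> (\<gamma> has_vector_derivative W (\<gamma> t)) (at t within {0..1})))
      - (x + W x)) \<le> 16 * A * D / norm x" (is "norm ((THE y. ?F y) - _) \<le> _")
proof -
  note nn = A_nonneg D_nonneg
  have bndW: "norm (W z) \<le> 4 * D" if "z \<noteq> 0" for z
    using bounded_P[of z] bounded_P[of "- z"] that norm_triangle_ineq4[of "P (- z)" "P z"]
    by (simp add: W_def)
  have lipW: "norm (W z - W z') \<le> 4 * A * e / r"
    if "0 < r" "r \<le> norm z" "z' \<noteq> 0" "norm (z - z') \<le> e" for z z' e r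
  proof -
    have "W z - W z' = 2 *\<^sub>R ((P (- z) - P (- z')) - (P z - P z'))"
      by (simp add: W_def algebra_simps)
    also have "norm \<dots> \<le> 2 * (norm (P (- z) - P (- z')) + norm (P z - P z'))"
      unfolding norm_scaleR by (intro mult_mono norm_triangle_ineq4) auto
    also have "\<dots> \<le> 2 * (A * e / r + A * e / r)"
      using that lipschitz_P'[of r z z' e] lipschitz_P'[of r "- z" "- z'" e]
      by (intro mult_left_mono add_mono) (auto simp: norm_minus_commute)
    finally show ?thesis by simp
  qed
  have far: "norm z \<ge> 8 * A + 1" if "z \<in> cball x (4 * D)" for z
    using norm_triangle_ineq2[of x z] that x nn by (simp add: dist_norm)
  then have nz: "z \<noteq> 0" if "z \<in> cball x (4 * D)" for z
    using that nn by fastforce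
  have lip: "norm (W z - W z') \<le> 1/2 * norm (z - z')"
    if "z \<in> cball x (4 * D)" "z' \<in> cball x (4 * D)" for z z'
  proof -
    have "norm (W z - W z') \<le> 4 * A * norm (z - z') / (8 * A + 1)"
      using far[OF that(1)] nz[OF that(2)] nn by (intro lipW) auto
    also have "\<dots> = 4 * A / (8 * A + 1) * norm (z - z')" by simp
    also have "\<dots> \<le> 1/2 * norm (z - z')"
      using nn by (intro mult_right_mono) (auto simp: field_simps)
    finally show ?thesis .
  qed
  \<comment> \<open>Confinement holds for every admissible curve, not only the Picard solution, as
    uniqueness of the endpoint demands.\<close>
  have ball: "\<gamma> t \<in> cball x (4 * D)"
    if "\<gamma> 0 = x" "\<forall>t\<in>{0..1}. \<gamma> t \<noteq> 0 \<and> (\<gamma> has_vector_derivative W (\<gamma> t)) (at t within {0..1})"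
      "t \<in> {0..1}" for \<gamma> t
    using norm_bound_unit_interval[of \<gamma> "\<lambda>t. W (\<gamma> t)" "4 * D" t] that bndW
    by (auto simp: dist_norm norm_minus_commute)
  have uniq: "\<gamma> 1 = \<delta> 1"
    if \<gamma>: "\<gamma> 0 = x" "\<forall>t\<in>{0..1}. \<gamma> t \<noteq> 0 \<and> (\<gamma> has_vector_derivative W (\<gamma> t)) (at t within {0..1})"
      and \<delta>: "\<delta> 0 = x" "\<forall>t\<in>{0..1}. \<delta> t \<noteq> 0 \<and> (\<delta> has_vector_derivative W (\<delta> t)) (at t within {0..1})"
    for \<gamma> \<delta>
  proof -
    let ?d = "\<lambda>t. \<gamma> t - \<delta> t"
    have deriv: "(?d has_vector_derivative W (\<gamma> t) - W (\<delta> t)) (at t within {0..1})"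
      if "t \<in> {0..1}" for t
      using \<gamma>(2) \<delta>(2) that by (intro has_vector_derivative_diff) auto
    then have "continuous_on {0..1} ?d"
      by (rule continuous_on_vector_derivative)
    then have "continuous_on {0..1} (\<lambda>t. norm (?d t))"
      by (rule continuous_on_norm)
    \<comment> \<open>At the time \<open>s\<close> of largest separation, the mean value inequality
      bounds the separation by half of itself, so it vanishes.\<close>
    then obtain s where s: "s \<in> {0..1}" "\<And>t. t \<in> {0..1} \<Longrightarrow> norm (?d t) \<le> norm (?d s)"
      using continuous_attains_sup[of "{0..1::real}" "\<lambda>t. norm (?d t)"] by auto
    have "norm (?d s - ?d 0) \<le> 1/2 * norm (?d s)"
    proof (rule norm_bound_unit_interval[OF deriv _ s(1)])
      fix t :: real assume t: "t \<in> {0..1}"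
      have "norm (W (\<gamma> t) - W (\<delta> t)) \<le> 1/2 * norm (?d t)"
        using ball[OF \<gamma> t] ball[OF \<delta> t] by (rule lip)
      with s(2)[OF t] show "norm (W (\<gamma> t) - W (\<delta> t)) \<le> 1/2 * norm (?d s)" by linarith
    qed
    then have "norm (?d s) = 0" using \<gamma>(1) \<delta>(1) by simp
    with s(2)[of 1] show ?thesis by simp
  qed
  obtain \<gamma> where "\<gamma> 0 = x" "\<And>t. t \<in> {0..1} \<Longrightarrow> \<gamma> t \<in> cball x (4 * D)"
    "\<And>t. t \<in> {0..1} \<Longrightarrow> (\<gamma> has_vector_derivative W (\<gamma> t)) (at t within {0..1})"
    using picard_unit_interval[of x "4 * D" W] bndW nz lip nn
    by (metis mult_nonneg_nonneg zero_le_numeral)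
  with nz have "?F (\<gamma> 1)" by blast
  moreover have "y = y'" if "?F y" "?F y'" for y y'
    using that uniq by blast
  ultimately have "\<exists>!y. ?F y" by blast
  then have "?F (THE y. ?F y)" by (rule theI')
  moreover have "norm (y - (x + W x)) \<le> 16 * A * D / norm x" if y: "?F y" for y
  proof -
    from y obtain \<gamma> where \<gamma>: "\<gamma> 0 = x" "\<gamma> 1 = y"
      "\<forall>t\<in>{0..1}. \<gamma> t \<noteq> 0 \<and> (\<gamma> has_vector_derivative W (\<gamma> t)) (at t within {0..1})"
      by blast
    \<comment> \<open>Subtracting uniform motion with velocity \<open>W x\<close> leaves a curve
      whose derivative is only the variation of \<open>W\<close>.\<close>
    let ?e = "\<lambda>t. \<gamma> t - t *\<^sub>R W x"
    have "norm (?e 1 - ?e 0) \<le> 4 * A * (4 * D) / norm x"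
    proof (rule norm_bound_unit_interval)
      fix t :: real assume t: "t \<in> {0..1}"
      show "(?e has_vector_derivative W (\<gamma> t) - W x) (at t within {0..1})"
        using \<gamma>(3) t by (auto intro!: derivative_eq_intros)
      have "norm x > 0" using x nn by linarith
      then have "norm (W x - W (\<gamma> t)) \<le> 4 * A * (4 * D) / norm x"
        using ball[OF \<gamma>(1,3) t] \<gamma>(3) t by (intro lipW) (auto simp: dist_norm)
      then show "norm (W (\<gamma> t) - W x) \<le> 4 * A * (4 * D) / norm x"
        by (simp add: norm_minus_commute)
    qed simp
    then show ?thesis using \<gamma> by (simp add: algebra_simps)
  qed
  ultimately show ?thesis by blast
qed

end


section \<open>Normalisation, the complex structure and Reeb vectors\<close>

text \<open>After factoring out \<open>1 / norm x\<close>, the difference splits into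
  \<open>x - y\<close> and a radial correction of length \<open>\<bar>norm y - norm x\<bar>\<close>;
  each is at most \<open>norm (x - y)\<close>.\<close>

lemma norm_normalize_diff_le:
  fixes x y :: "'a::real_normed_vector"
  assumes "x \<noteq> 0" "y \<noteq> 0"
  shows "norm ((1 / norm x) *\<^sub>R x - (1 / norm y) *\<^sub>R y) \<le> 2 * norm (x - y) / norm x"
proof -
  have "(1 / norm x) *\<^sub>R x - (1 / norm y) *\<^sub>R y
      = (1 / norm x) *\<^sub>R ((x - y) + ((norm y - norm x) / norm y) *\<^sub>R y)"
    using assms by (simp add: algebra_simps diff_divide_distrib)
  also have "norm \<dots> = norm ((x - y) + ((norm y - norm x) / norm y) *\<^sub>R y) / norm x"
    by simp
  also have "\<dots> \<le> (norm (x - y) + norm (((norm y - norm x) / norm y) *\<^sub>R y)) / norm x"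
    by (intro divide_right_mono norm_triangle_ineq norm_ge_zero)
  also have "\<dots> \<le> (norm (x - y) + norm (x - y)) / norm x"
    using assms norm_triangle_ineq3[of y x]
    by (intro divide_right_mono add_mono) (auto simp: norm_minus_commute)
  finally show ?thesis by simp
qed

lemma linear_Jcx: "linear Jcx"
  by (rule linearI) (auto simp: Jcx_def)

lemmas Jcx_scaleR = linear_scale[OF linear_Jcx]
  and Jcx_diff = linear_diff[OF linear_Jcx]
  and Jcx_minus = linear_neg[OF linear_Jcx]

lemma Jcx_Jcx: "Jcx (Jcx x) = - x"
  by (simp add: Jcx_def prod_eq_iff)

lemma inner_Jcx_Jcx: "Jcx x \<bullet> Jcx y = x \<bullet> y"
  by (simp add: Jcx_def inner_prod_def)

lemma inner_Jcx_left: "Jcx x \<bullet> y = - (x \<bullet> Jcx y)"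
  by (simp add: Jcx_def inner_prod_def)

lemma norm_Jcx: "norm (Jcx x) = norm x"
  by (simp add: norm_eq_sqrt_inner inner_Jcx_Jcx)

lemma Jcx_eq_0_iff: "Jcx x = 0 \<longleftrightarrow> x = 0"
  by (metis norm_Jcx norm_eq_zero)

text \<open>Vanishing of \<open>omega\<close> against tangent vectors forces \<open>Jcx R\<close> to
  be normal, hence a multiple of the gradient; the condition \<open>omega q R = 1\<close> fixes the
  multiple.\<close>

lemma reeb_eq:
  assumes "q \<bullet> gradf f q > 0"
  shows "reeb f q = (1 / (q \<bullet> gradf f q)) *\<^sub>R Jcx (gradf f q)"
proof -
  let ?g = "gradf f q"
  have "?g \<noteq> 0" using assms by auto
  show ?thesis
    unfolding reeb_def
  proof (rule the_equality)
    show "(\<forall>v\<in>tspace f q. omega v ((1 / (q \<bullet> ?g)) *\<^sub>R Jcx ?g) = 0) \<and>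
        omega q ((1 / (q \<bullet> ?g)) *\<^sub>R Jcx ?g) = 1"
      using assms by (auto simp: tspace_def omega_def inner_Jcx_Jcx)
    fix R assume R: "(\<forall>v\<in>tspace f q. omega v R = 0) \<and> omega q R = 1"
    \<comment> \<open>Orthogonal projection of \<open>Jcx R\<close> onto the gradient line. The
      residual \<open>v\<close> is tangent, so it is orthogonal to both \<open>?g\<close> and
      \<open>Jcx R\<close>, and therefore to itself.\<close>
    define k where "k = (Jcx R \<bullet> ?g) / (?g \<bullet> ?g)"
    define v where "v = Jcx R - k *\<^sub>R ?g"
    have vg: "v \<bullet> ?g = 0"
      using \<open>?g \<noteq> 0\<close> by (simp add: v_def k_def inner_diff_left)
    then have "omega v R = 0"
      using R unfolding tspace_def by blast
    then have "v \<bullet> Jcx R = 0"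
      by (simp add: omega_def inner_Jcx_left)
    with vg have "v \<bullet> v = 0"
      by (subst (2) v_def) (simp add: inner_diff_right)
    then have JR: "Jcx R = k *\<^sub>R ?g" by (simp add: v_def)
    then have "- R = k *\<^sub>R Jcx ?g"
      by (metis Jcx_Jcx Jcx_scaleR)
    then have R_eq: "R = (- k) *\<^sub>R Jcx ?g"
      by (metis minus_minus scaleR_minus_left)
    have "- k * (q \<bullet> ?g) = omega q R"
      unfolding R_eq by (simp add: omega_def inner_Jcx_Jcx)
    then have "- k = 1 / (q \<bullet> ?g)"
      using R assms by (simp add: field_simps)
    with R_eq show "R = (1 / (q \<bullet> ?g)) *\<^sub>R Jcx ?g" by metis
  qed
qed

text \<open>The Reeb vector is a positive multiple of \<open>Jcx (gradf f m)\<close>, so applying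
  \<open>Jcx\<close> to \<open>x - m\<close> yields a positive multiple of the gradient. Tangency
  thus becomes a condition on the unit normal.\<close>

lemma posprop_reeb_iff:
  assumes "m \<bullet> gradf f m > 0"
  shows "posprop (m - x) (reeb f m) \<longleftrightarrow> m \<noteq> x \<and> gauss f m = (1 / norm (x - m)) *\<^sub>R Jcx (x - m)"
proof -
  let ?g = "gradf f m"
  define a where "a = m \<bullet> ?g"
  have a: "a > 0" and g: "?g \<noteq> 0" using assms by (auto simp: a_def)
  have R: "reeb f m = (1 / a) *\<^sub>R Jcx ?g"
    using reeb_eq[OF assms] by (simp add: a_def)
  show ?thesis
  proof
    assume "posprop (m - x) (reeb f m)"
    then obtain l where l: "l > 0" "m - x = (l / a) *\<^sub>R Jcx ?g"
      by (auto simp: posprop_def R)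
    have "x - m = - ((l / a) *\<^sub>R Jcx ?g)"
      by (simp flip: l(2))
    then have J: "Jcx (x - m) = (l / a) *\<^sub>R ?g"
      by (simp add: Jcx_minus Jcx_scaleR Jcx_Jcx)
    then have n: "norm (x - m) = (l / a) * norm ?g"
      using l(1) a norm_Jcx[of "x - m"] by simp
    then have "m \<noteq> x"
      using l(1) a g by auto
    moreover have "gauss f m = (1 / norm (x - m)) *\<^sub>R Jcx (x - m)"
      unfolding J n gauss_def using l(1) a by simp
    ultimately show "m \<noteq> x \<and> gauss f m = (1 / norm (x - m)) *\<^sub>R Jcx (x - m)" ..
  next
    assume r: "m \<noteq> x \<and> gauss f m = (1 / norm (x - m)) *\<^sub>R Jcx (x - m)"
    have "m - x = Jcx (Jcx (x - m))"
      by (simp add: Jcx_Jcx)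
    also have "Jcx (x - m) = norm (x - m) *\<^sub>R gauss f m"
      using r by (simp add: Jcx_eq_0_iff)
    also have "Jcx \<dots> = (norm (x - m) / norm ?g * a) *\<^sub>R reeb f m"
      using a by (simp add: gauss_def R Jcx_scaleR)
    finally show "posprop (m - x) (reeb f m)"
      unfolding posprop_def using r a g by (intro exI[of _ "norm (x - m) / norm ?g * a"]) auto
  qed
qed

section \<open>Application to the hypersurface\<close>

lemma n_plus_eq_n_minus: "n_plus f c x = n_minus f c (- x)"
  by (simp add: n_plus_def n_minus_def Jcx_minus)

theorem theorem3p4:
  fixes f :: "'d::finite ps \<Rightarrow> real" and c :: real
  assumes smooth_f: "smooth f"
    and hess_pos: "\<And>x h. h \<noteq> 0 \<Longrightarrow> hess_form f x h > 0"
    and origin_inside: "f 0 < c"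
    and bounded_dom: "bounded {x. f x \<le> c}"
  shows "\<exists>\<Delta>>0. \<exists>K>0. \<forall>x. norm x \<ge> 1 / \<Delta> \<longrightarrow>
           norm (osb f c (osb f c x) - time_one f c x) \<le> K / norm x"
proof -
  let ?M = "Mset f c" and ?P = "n_minus f c"
  have radial: "m \<bullet> gradf f m > 0" if "f m = c" for m
    using inner_gradf_pos[OF smooth_f hess_pos] origin_inside that by simp
  then have grad: "gradf f m \<noteq> 0" if "f m = c" for m
    using that by fastforce
  obtain L where L: "L > 0"
    "\<And>p q. \<lbrakk>p \<in> ?M; q \<in> ?M\<rbrakk> \<Longrightarrow> norm (p - q) \<le> L * norm (gauss f p - gauss f q)"
    using gauss_expanding[OF smooth_f hess_pos grad bounded_dom] by metis
  have inj: "inj_on (gauss f) ?M"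
  proof (rule inj_onI)
    show "p = q" if "p \<in> ?M" "q \<in> ?M" "gauss f p = gauss f q" for p q
      using L(2)[OF that(1,2)] that(3) by simp
  qed
  have unit: "norm ((1 / norm x) *\<^sub>R Jcx x) = 1" if "x \<noteq> 0" for x :: "'d ps"
    using that by (simp add: norm_Jcx)
  have P: "?P x \<in> ?M" "gauss f (?P x) = (1 / norm x) *\<^sub>R Jcx x" if "x \<noteq> 0" for x
  proof -
    have "(1 / norm x) *\<^sub>R Jcx x \<in> gauss f ` ?M"
      using gauss_surj[OF smooth_f grad origin_inside bounded_dom unit[OF that]] by force
    then show "?P x \<in> ?M" "gauss f (?P x) = (1 / norm x) *\<^sub>R Jcx x"
      unfolding n_minus_def by (rule inv_into_into, rule f_inv_into_f)
  qed
  obtain D where D: "D > 0" "\<And>m. f m \<le> c \<Longrightarrow> norm m \<le> D"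
    using bounded_dom by (auto simp: bounded_pos)
  \<comment> \<open>\<open>L\<close> is the Lipschitz constant of the inverse Gauss map, and the
    factor 2 comes from normalising vectors; \<open>Jcx\<close> is an isometry.\<close>
  interpret inverse_decay_lipschitz ?P "2 * L" D
  proof
    show "norm (?P x) \<le> D" if "x \<noteq> 0" for x
      using P(1)[OF that] D(2) by (simp add: Mset_def)
    fix x y :: "'d ps" assume nz: "x \<noteq> 0" "y \<noteq> 0"
    have "norm (?P x - ?P y) \<le> L * norm (gauss f (?P x) - gauss f (?P y))"
      by (intro L(2) P(1) nz)
    also have "\<dots> = L * norm ((1 / norm (Jcx x)) *\<^sub>R Jcx x - (1 / norm (Jcx y)) *\<^sub>R Jcx y)"
      by (simp only: P(2)[OF nz(1)] P(2)[OF nz(2)] norm_Jcx)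
    also have "\<dots> \<le> L * (2 * norm (Jcx x - Jcx y) / norm (Jcx x))"
      using L(1) nz by (intro mult_left_mono norm_normalize_diff_le) (auto simp: Jcx_eq_0_iff)
    also have "\<dots> = 2 * L * norm (x - y) / norm x"
      by (simp add: norm_Jcx flip: Jcx_diff)
    finally show "norm (?P x - ?P y) \<le> 2 * L * norm (x - y) / norm x" .
  qed (use L(1) D(1) in auto)
  \<comment> \<open>The condition defining \<open>m_minus\<close> becomes the fixed-point equation;
    injectivity of the Gauss map recovers \<open>m\<close> from its normal.\<close>
  have m_iff: "m \<in> ?M \<and> posprop (m - x) (reeb f m) \<longleftrightarrow> m \<noteq> x \<and> ?P (x - m) = m" for m x
  proof (cases "m = x")
    case True
    then show ?thesis
      using posprop_reeb_iff[OF radial, of m x] by (auto simp: Mset_def)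
  next
    case False
    then have nz: "x - m \<noteq> 0" by simp
    have "?P (x - m) = m \<longleftrightarrow> m \<in> ?M \<and> gauss f m = (1 / norm (x - m)) *\<^sub>R Jcx (x - m)"
      using P[OF nz] inj by (metis inj_onD)
    with False show ?thesis
      using posprop_reeb_iff[OF radial, of m x] by (auto simp: Mset_def)
  qed
  have m: "m_minus f c x \<noteq> x \<and> ?P (x - m_minus f c x) = m_minus f c x"
    if "norm x \<ge> D + 2 * (2 * L) + 1" for x
    unfolding m_minus_def m_iff using ex1_fixed_point[OF that] by (rule theI')
  define \<rho> where "\<rho> = 8 * D + 8 * (2 * L) + 1"
  \<comment> \<open>With \<open>A = 2 * L\<close> the errors \<open>10 * A * D\<close> and
    \<open>16 * A * D\<close> become \<open>20 * L * D\<close> and \<open>32 * L * D\<close>, which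
    add up to the constant 52.\<close>
  have "norm (osb f c (osb f c x) - time_one f c x) \<le> 52 * L * D / norm x" if x: "norm x \<ge> \<rho>" for x
  proof -
    let ?z = "x + 2 *\<^sub>R (?P (- x) - ?P x)"
    have T2: "norm (osb f c (osb f c x) - ?z) \<le> 20 * (L * D / norm x)"
      using second_reflection_estimate[where m = "m_minus f c", OF m osb_def, of x] x
      by (simp add: \<rho>_def mult.assoc)
    have F: "norm (time_one f c x - ?z) \<le> 32 * (L * D / norm x)"
      using time_one_estimate[of x] x
      by (simp add: \<rho>_def time_one_def Vfield_def n_plus_eq_n_minus mult.assoc)
    have "norm (osb f c (osb f c x) - time_one f c x)
        \<le> norm (osb f c (osb f c x) - ?z) + norm (time_one f c x - ?z)"
      using norm_triangle_ineq4[of "osb f c (osb f c x) - ?z" "time_one f c x - ?z"] by simp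
    also have "\<dots> \<le> 20 * (L * D / norm x) + 32 * (L * D / norm x)"
      by (rule add_mono[OF T2 F])
    finally show ?thesis
      by (simp add: mult.assoc flip: distrib_right add_divide_distrib)
  qed
  moreover have "\<rho> > 0" "52 * L * D > 0"
    using L(1) D(1) by (auto simp: \<rho>_def)
  ultimately show ?thesis
    by (intro exI[of _ "1 / \<rho>"] exI[of _ "52 * L * D"] conjI) auto
qed

end
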